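(* Let $H$ be a Hilbert space (not necessarily separable), let $M \subseteq B(H)$ be a von Neumann algebra, and let $\phi = \{\phi_t\}_{t \geq 0}$ be a CP-semigroup on $M$. Then for all $\xi \in H$, $A \in M$ and $t_0 \geq 0$, $$\lim_{t \to t_0} \|\phi_t(A)\xi - \phi_{t_0}(A)\xi\| = 0.$$
   Context: A CP-semigroup on a von Neumann algebra $M$ is a family $\phi = \{\phi_t : M \to M\}_{t \geq 0}$ of contractive normal completely positive maps such that $\phi_0(A) = A$ for all $A \in M$, $\phi_{s+t} = \phi_s \circ \phi_t$ for all $s,t \geq 0$, and for all $A \in M$ and all $\sigma$-weakly continuous linear functionals $\omega$ on $M$ (elements of the predual $M_*$), $\lim_{t \to t_0} \omega(\phi_t(A)) = \omega(\phi_{t_0}(A))$ for every $t_0 \geq 0$. *)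

theory Defs
  imports "HOL-Analysis.Analysis"
begin

class chilbert = real_normed_vector + complete_space +
  fixes cscale :: "complex \<Rightarrow> 'a \<Rightarrow> 'a"
    and cinner :: "'a \<Rightarrow> 'a \<Rightarrow> complex"
  assumes cscale_of_real: "cscale (of_real r) x = scaleR r x"
    and cscale_add_right: "cscale a (x + y) = cscale a x + cscale a y"
    and cscale_add_left: "cscale (a + b) x = cscale a x + cscale b x"
    and cscale_cscale: "cscale a (cscale b x) = cscale (a * b) x"
    and cscale_one: "cscale 1 x = x"
    and cinner_conj: "cinner x y = cnj (cinner y x)"
    and cinner_add_right: "cinner x (y + z) = cinner x y + cinner x z"
    and cinner_cscale_right: "cinner x (cscale a y) = a * cinner x y"
    and norm_cinner: "norm x = sqrt (Re (cinner x x))"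

definition bounded_op :: "('h::chilbert \<Rightarrow> 'h) \<Rightarrow> bool" where
  "bounded_op T \<longleftrightarrow> (\<forall>x y. T (x + y) = T x + T y) \<and> (\<forall>a x. T (cscale a x) = cscale a (T x))
     \<and> (\<exists>K. \<forall>x. norm (T x) \<le> K * norm x)"

definition adjoint_op :: "('h::chilbert \<Rightarrow> 'h) \<Rightarrow> ('h \<Rightarrow> 'h)" where
  "adjoint_op T = (SOME S. \<forall>x y. cinner (T x) y = cinner x (S y))"

definition commutant :: "('h::chilbert \<Rightarrow> 'h) set \<Rightarrow> ('h \<Rightarrow> 'h) set" where
  "commutant S = {T. bounded_op T \<and> (\<forall>A\<in>S. T \<circ> A = A \<circ> T)}"

text \<open>A von Neumann algebra M in B(H): a self-adjoint set of bounded operators equal to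
  its bicommutant (equivalently, a unital weak-operator closed *-subalgebra).\<close>
definition von_neumann_algebra :: "('h::chilbert \<Rightarrow> 'h) set \<Rightarrow> bool" where
  "von_neumann_algebra M \<longleftrightarrow> M \<subseteq> Collect bounded_op \<and> (\<forall>A\<in>M. adjoint_op A \<in> M)
     \<and> commutant (commutant M) = M"

definition sw_functional :: "(nat \<Rightarrow> 'h::chilbert) \<Rightarrow> (nat \<Rightarrow> 'h) \<Rightarrow> ('h \<Rightarrow> 'h) \<Rightarrow> complex" where
  "sw_functional \<xi> \<eta> A = (\<Sum>n. cinner (\<xi> n) (A (\<eta> n)))"

definition sigma_weak_topology :: "('h::chilbert \<Rightarrow> 'h) topology" where
  "sigma_weak_topology = topology_generated_by
     {{A. sw_functional \<xi> \<eta> A \<in> U} | \<xi> \<eta> U.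
        summable (\<lambda>n. (norm (\<xi> n))\<^sup>2) \<and> summable (\<lambda>n. (norm (\<eta> n))\<^sup>2) \<and> open U}"

definition normal_functional :: "('h::chilbert \<Rightarrow> 'h) set \<Rightarrow> (('h \<Rightarrow> 'h) \<Rightarrow> complex) \<Rightarrow> bool" where
  "normal_functional M \<omega> \<longleftrightarrow>
     (\<forall>A\<in>M. \<forall>B\<in>M. \<omega> (\<lambda>x. A x + B x) = \<omega> A + \<omega> B)
   \<and> (\<forall>A\<in>M. \<forall>c. \<omega> (\<lambda>x. cscale c (A x)) = c * \<omega> A)
   \<and> continuous_map (subtopology sigma_weak_topology M) euclidean \<omega>"

text \<open>An n x n matrix of operators (indices < n) is positive as an operator on H^n,
  i.e. sum_(i,j) <xi_i, X_ij xi_j> >= 0 for all xi_1..xi_n.\<close>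
definition positive_op_matrix :: "nat \<Rightarrow> (nat \<Rightarrow> nat \<Rightarrow> ('h::chilbert \<Rightarrow> 'h)) \<Rightarrow> bool" where
  "positive_op_matrix n X \<longleftrightarrow> (\<forall>\<xi> :: nat \<Rightarrow> 'h.
     let s = (\<Sum>i<n. \<Sum>j<n. cinner (\<xi> i) (X i j (\<xi> j))) in Im s = 0 \<and> Re s \<ge> 0)"

definition completely_positive :: "('h::chilbert \<Rightarrow> 'h) set \<Rightarrow> (('h \<Rightarrow> 'h) \<Rightarrow> ('h \<Rightarrow> 'h)) \<Rightarrow> bool" where
  "completely_positive M \<Phi> \<longleftrightarrow> (\<forall>n X. (\<forall>i<n. \<forall>j<n. X i j \<in> M) \<and> positive_op_matrix n X
      \<longrightarrow> positive_op_matrix n (\<lambda>i j. \<Phi> (X i j)))"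

definition normal_cp_contraction :: "('h::chilbert \<Rightarrow> 'h) set \<Rightarrow> (('h \<Rightarrow> 'h) \<Rightarrow> ('h \<Rightarrow> 'h)) \<Rightarrow> bool" where
  "normal_cp_contraction M \<Phi> \<longleftrightarrow>
     \<Phi> ` M \<subseteq> M
   \<and> (\<forall>A\<in>M. \<forall>B\<in>M. \<Phi> (\<lambda>x. A x + B x) = (\<lambda>x. \<Phi> A x + \<Phi> B x))
   \<and> (\<forall>A\<in>M. \<forall>c. \<Phi> (\<lambda>x. cscale c (A x)) = (\<lambda>x. cscale c (\<Phi> A x)))
   \<and> (\<forall>A\<in>M. onorm (\<Phi> A) \<le> onorm A)
   \<and> continuous_map (subtopology sigma_weak_topology M) sigma_weak_topology \<Phi>
   \<and> completely_positive M \<Phi>"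

definition cp_semigroup :: "('h::chilbert \<Rightarrow> 'h) set \<Rightarrow> (real \<Rightarrow> ('h \<Rightarrow> 'h) \<Rightarrow> ('h \<Rightarrow> 'h)) \<Rightarrow> bool" where
  "cp_semigroup M \<phi> \<longleftrightarrow>
     (\<forall>t\<ge>0. normal_cp_contraction M (\<phi> t))
   \<and> (\<forall>A\<in>M. \<phi> 0 A = A)
   \<and> (\<forall>s\<ge>0. \<forall>t\<ge>0. \<forall>A\<in>M. \<phi> (s + t) A = \<phi> s (\<phi> t A))
   \<and> (\<forall>A\<in>M. \<forall>\<omega>. normal_functional M \<omega> \<longrightarrow>
        (\<forall>t0\<ge>0. ((\<lambda>t. \<omega> (\<phi> t A)) \<longlongrightarrow> \<omega> (\<phi> t0 A)) (at t0 within {0..})))"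

end

theory Submission
  imports Defs
begin

text \<open>
  Right continuity at \<open>0\<close>, hence everywhere, follows from weak continuity and the Kadison--Schwarz
  inequality \<open>\<phi>\<^sub>t(A)*\<phi>\<^sub>t(A) \<le> \<phi>\<^sub>t(A*A)\<close>. A right-continuous function into a metric space has at most
  countably many discontinuities. Now fix \<open>\<xi>\<close>. Each of the normal functionals \<open>\<omega>\<^sub>r = \<langle>\<xi>, \<phi>\<^sub>r(\<cdot>)\<xi>\<rangle>\<close> with
  \<open>r\<close> rational vanishes on every operator in \<open>M\<close> that annihilates some countable set of vectors. Let \<open>S\<close>
  be the union of these sets and \<open>p \<in> M\<close> the projection onto the closed span of \<open>M'S\<close>; by weak
  continuity \<open>\<omega>\<^sub>r(1 - p) = 0\<close> for all \<open>r \<ge> 0\<close>.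

  For \<open>t\<^sub>0 > 0\<close> choose \<open>r \<in> (0, t\<^sub>0)\<close> such that \<open>t \<mapsto> \<phi>\<^sub>t(A)v\<close> is continuous at \<open>t\<^sub>0 - r\<close> for every \<open>v \<in> S\<close>.
  Then \<open>E\<^sub>s = \<phi>\<^bsub>s-r\<^esub>(A) - \<phi>\<^bsub>t\<^sub>0-r\<^esub>(A)\<close> is bounded and tends strongly to \<open>0\<close> on \<open>pH\<close> as \<open>s \<rightarrow> t\<^sub>0\<close>, so that
  \<open>\<parallel>\<phi>\<^sub>s(A)\<xi> - \<phi>\<^bsub>t\<^sub>0\<^esub>(A)\<xi>\<parallel>\<^sup>2 = \<parallel>\<phi>\<^sub>r(E\<^sub>sp)\<xi>\<parallel>\<^sup>2 \<le> \<omega>\<^sub>r((E\<^sub>sp)*(E\<^sub>sp)) \<rightarrow> 0\<close> by normality of \<open>\<phi>\<^sub>r\<close>.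
\<close>

section \<open>Preliminaries from analysis\<close>

text \<open>The gaps to the right of distinct points are disjoint, so a rational picked in each gap
  determines its point.\<close>

lemma countable_right_isolated:
  fixes D :: "real set"
  assumes "\<And>t. t \<in> D \<Longrightarrow> \<exists>d>0. \<forall>s\<in>D. s \<le> t \<or> t + d \<le> s"
  shows "countable D"
proof -
  obtain d where d: "\<And>t. t \<in> D \<Longrightarrow> d t > 0" "\<And>t s. t \<in> D \<Longrightarrow> s \<in> D \<Longrightarrow> s \<le> t \<or> t + d t \<le> s"
    using assms by metis
  have "\<exists>q\<in>\<rat>. t < q \<and> q < t + d t" if "t \<in> D" for t
    using Rats_dense_in_real[of t "t + d t"] d(1)[OF that] by auto
  then obtain q where q: "\<And>t. t \<in> D \<Longrightarrow> q t \<in> \<rat> \<and> t < q t \<and> q t < t + d t"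
    by metis
  have "inj_on q D"
  proof (rule inj_onI)
    fix s t assume "s \<in> D" "t \<in> D" "q s = q t"
    then show "s = t"
      using d(2)[of s t] d(2)[of t s] q[of s] q[of t] by linarith
  qed
  moreover have "countable (q ` D)"
    by (rule countable_subset[OF _ countable_rat]) (use q in auto)
  ultimately show ?thesis
    using countable_image_inj_on by blast
qed

text \<open>Sort the discontinuities by the size \<open>e\<close> of the jump. Right continuity at
  \<open>t\<close> forbids further jumps of that size just to the right of \<open>t\<close>, so each
  \<open>D e\<close> is right-isolated.\<close>

lemma countable_discontinuities_right_continuous:
  fixes f :: "real \<Rightarrow> 'a::metric_space"
  assumes "\<And>t. t \<ge> 0 \<Longrightarrow> (f \<longlongrightarrow> f t) (at_right t)"
  shows "countable {t. t \<ge> 0 \<and> \<not> isCont f t}"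
proof -
  define D where "D e = {t. t \<ge> 0 \<and> (\<forall>d>0. \<exists>x. dist x t < d \<and> dist (f x) (f t) \<ge> e)}" for e
  have "countable (D e)" if e: "e > 0" for e
  proof (rule countable_right_isolated)
    fix t assume "t \<in> D e"
    then have "t \<ge> 0" by (simp add: D_def)
    then have "\<forall>\<^sub>F x in at_right t. dist (f x) (f t) < e / 2"
      using assms e by (intro tendstoD) auto
    then obtain b where b: "b > t" "\<And>x. t < x \<Longrightarrow> x < b \<Longrightarrow> dist (f x) (f t) < e / 2"
      by (auto simp: eventually_at_right_field)
    have "s \<notin> D e" if s: "t < s" "s < b" for s
    proof -
      \<comment> \<open>This radius keeps \<open>x\<close> inside \<open>(t, b)\<close>, where
        \<open>f x\<close> and \<open>f s\<close> are both within \<open>e / 2\<close> of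
        \<open>f t\<close>.\<close>
      have "dist (f x) (f s) < e" if x: "dist x s < min (s - t) (b - s)" for x
        using b(2)[of x] b(2)[of s] s x dist_triangle_half_l[of "f x" "f t" e "f s"]
        by (auto simp: dist_real_def dist_commute abs_if split: if_splits)
      then show ?thesis
        using s by (auto simp: D_def not_le intro!: exI[of _ "min (s - t) (b - s)"])
    qed
    then show "\<exists>d>0. \<forall>s\<in>D e. s \<le> t \<or> t + d \<le> s"
      using b(1) by (intro exI[of _ "b - t"]) (auto simp: not_less[symmetric])
  qed
  then have "countable (\<Union>n. D (1 / Suc n))"
    by simp
  moreover have "t \<in> (\<Union>n. D (1 / Suc n))" if t: "t \<ge> 0" "\<not> isCont f t" for t
  proof -
    obtain e where e: "e > 0" "\<And>d. d > 0 \<Longrightarrow> \<exists>x. dist x t < d \<and> dist (f x) (f t) \<ge> e"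
      using t(2) unfolding continuous_at_eps_delta by (force simp: not_less)
    obtain n where "inverse (real (Suc n)) < e"
      using reals_Archimedean[OF e(1)] by blast
    then have "t \<in> D (1 / Suc n)"
      using t(1) e(2) unfolding D_def inverse_eq_divide by (blast intro: order_trans[OF less_imp_le])
    then show ?thesis by blast
  qed
  then have "{t. t \<ge> 0 \<and> \<not> isCont f t} \<subseteq> (\<Union>n. D (1 / Suc n))"
    by blast
  ultimately show ?thesis
    by (rule countable_subset[rotated])
qed

text \<open>The vectors along which \<open>E s\<close> tends to 0 form a subspace, and the bound
  uniform in \<open>s\<close> makes that subspace closed.\<close>

lemma tendsto_zero_closure_span:
  fixes E :: "'s \<Rightarrow> 'a::real_normed_vector \<Rightarrow> 'b::real_normed_vector"
  assumes lin: "\<And>s. linear (E s)" and bound: "\<And>s v. norm (E s v) \<le> C * norm v"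
    and G: "\<And>v. v \<in> G \<Longrightarrow> ((\<lambda>s. E s v) \<longlongrightarrow> 0) F" and v: "v \<in> closure (span G)"
  shows "((\<lambda>s. E s v) \<longlongrightarrow> 0) F"
proof -
  define Z where "Z = {v. ((\<lambda>s. E s v) \<longlongrightarrow> 0) F}"
  have "subspace Z"
    unfolding subspace_def
  proof (intro conjI ballI allI)
    show "0 \<in> Z"
      by (simp add: Z_def linear_0[OF lin])
    show "x + y \<in> Z" if "x \<in> Z" "y \<in> Z" for x y
      using that tendsto_add[of "\<lambda>s. E s x" 0 F "\<lambda>s. E s y" 0] by (simp add: Z_def linear_add[OF lin])
    show "c *\<^sub>R x \<in> Z" if "x \<in> Z" for c x
      using that tendsto_scaleR[OF tendsto_const, of "\<lambda>s. E s x" 0 F c]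
      by (simp add: Z_def linear_scale[OF lin])
  qed
  then have "span G \<subseteq> Z"
    using G by (intro span_minimal) (auto simp: Z_def)
  show ?thesis
  proof (rule tendstoI)
    fix e :: real assume e: "e > 0"
    \<comment> \<open>The added 1 keeps the denominator positive; approximating within
      \<open>d\<close> then costs at most \<open>e / 2\<close>.\<close>
    define d where "d = e / (2 * (\<bar>C\<bar> + 1))"
    have d: "d > 0" using e by (simp add: d_def)
    obtain z where z: "z \<in> span G" "dist z v < d"
      using v d by (auto simp: closure_approachable)
    have "norm (E s (v - z)) \<le> e / 2" for s
    proof -
      have "norm (E s (v - z)) \<le> C * norm (v - z)" by (rule bound)
      also have "\<dots> \<le> (\<bar>C\<bar> + 1) * d"
        using z(2) by (intro mult_mono) (auto simp: dist_norm norm_minus_commute)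
      also have "\<dots> = e / 2"
        by (simp add: d_def divide_simps)
      finally show ?thesis .
    qed
    then have near: "norm (E s v) \<le> e / 2 + norm (E s z)" for s
      using norm_triangle_ineq[of "E s (v - z)" "E s z"]
      by (simp add: linear_diff[OF lin] order_trans[OF _ add_right_mono])
    have "\<forall>\<^sub>F s in F. dist (E s z) 0 < e / 2"
      using z(1) \<open>span G \<subseteq> Z\<close> e by (intro tendstoD) (auto simp: Z_def)
    then show "\<forall>\<^sub>F s in F. dist (E s v) 0 < e"
    proof eventually_elim
      case (elim s)
      then show ?case
        using near[of s] by simp
    qed
  qed
qed

lemma subspace_closure:
  fixes V :: "'a::real_normed_vector set"
  assumes "subspace V" shows "subspace (closure V)"
  unfolding subspace_def
proof (intro conjI ballI allI)
  show "0 \<in> closure V"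
    using subspace_0[OF assms] closure_subset by blast
  show "x + y \<in> closure V" if "x \<in> closure V" "y \<in> closure V" for x y
    using that subspace_add[OF assms] unfolding closure_sequential
    by (metis (no_types, lifting) tendsto_add)
  show "c *\<^sub>R x \<in> closure V" if "x \<in> closure V" for c x
    using that subspace_scale[OF assms] unfolding closure_sequential
    by (metis (no_types, lifting) tendsto_scaleR tendsto_const)
qed

section \<open>Complex Hilbert spaces\<close>

lemma cinner_add_left: "cinner (x + y) z = cinner x z + cinner y (z::'h::chilbert)"
  by (metis cinner_add_right cinner_conj complex_cnj_add)

lemma cinner_cscale_left: "cinner (cscale a x) y = cnj a * cinner x (y::'h::chilbert)"
  by (metis cinner_cscale_right cinner_conj complex_cnj_mult)

lemma cinner_scaleR_right: "cinner x (scaleR r y) = of_real r * cinner x (y::'h::chilbert)"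
  by (metis cinner_cscale_right cscale_of_real)

lemma cinner_scaleR_left: "cinner (scaleR r x) y = of_real r * cinner x (y::'h::chilbert)"
  by (metis cinner_cscale_left cscale_of_real complex_cnj_complex_of_real)

lemma cinner_zero_right [simp]: "cinner x (0::'h::chilbert) = 0"
  using cinner_scaleR_right[of x 0 x] by simp

lemma cinner_zero_left [simp]: "cinner (0::'h::chilbert) x = 0"
  using cinner_scaleR_left[of 0 x x] by simp

lemma cinner_minus_right: "cinner x (- y) = - cinner x (y::'h::chilbert)"
  using cinner_scaleR_right[of x "-1" y] by simp

lemma cinner_minus_left: "cinner (- x) y = - cinner x (y::'h::chilbert)"
  using cinner_scaleR_left[of "-1" x y] by simp

lemma cinner_diff_right: "cinner x (y - z) = cinner x y - cinner x (z::'h::chilbert)"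
  using cinner_add_right[of x y "- z"] by (simp add: cinner_minus_right)

lemma cinner_diff_left: "cinner (x - y) z = cinner x z - cinner y (z::'h::chilbert)"
  using cinner_add_left[of x "- y" z] by (simp add: cinner_minus_left)

lemmas cinner_simps = cinner_add_left cinner_add_right cinner_diff_left cinner_diff_right
  cinner_minus_left cinner_minus_right cinner_scaleR_left cinner_scaleR_right
  cinner_cscale_left cinner_cscale_right

lemma cscale_minus_one: "cscale (- 1) x = - (x::'h::chilbert)"
  using cscale_of_real[of "-1" x] by simp

lemma cscale_diff_right: "cscale a (x - y) = cscale a x - cscale a (y::'h::chilbert)"
  by (metis add_diff_cancel_right' cscale_add_right diff_add_cancel)

lemma cscale_zero_right [simp]: "cscale a (0::'h::chilbert) = 0"
  using cscale_diff_right[of a 0 0] by simp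

lemma Re_cinner_commute: "Re (cinner x y) = Re (cinner y (x::'h::chilbert))"
  using arg_cong[OF cinner_conj[of x y], of Re] by simp

lemma Re_cinner_self: "Re (cinner x x) = (norm (x::'h::chilbert))\<^sup>2"
proof -
  have "0 \<le> sqrt (Re (cinner x x))"
    using norm_cinner[of x] norm_ge_zero[of x] by linarith
  then have "0 \<le> Re (cinner x x)"
    by simp
  then show ?thesis
    using norm_cinner[of x] by simp
qed

lemma cinner_self: "cinner x x = of_real ((norm (x::'h::chilbert))\<^sup>2)"
proof (rule complex_eqI)
  show "Im (cinner x x) = Im (of_real ((norm x)\<^sup>2))"
    using arg_cong[OF cinner_conj[of x x], of Im] by simp
qed (simp add: Re_cinner_self)

lemma norm_cscale: "norm (cscale a x) = cmod a * norm (x::'h::chilbert)"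
proof -
  have "(norm (cscale a x))\<^sup>2 = Re (a * cnj a * cinner x x)"
    by (simp add: Re_cinner_self[symmetric] cinner_simps mult.assoc)
  also have "\<dots> = (cmod a * norm x)\<^sup>2"
    by (simp add: complex_norm_square[symmetric] Re_cinner_self power_mult_distrib
        del: of_real_power flip: of_real_power)
  finally show ?thesis
    by (rule power2_eq_imp_eq) auto
qed

section \<open>Norm expansions and the Cauchy-Schwarz inequality\<close>

lemma norm_add_square:
  "(norm (x + y))\<^sup>2 = (norm x)\<^sup>2 + 2 * Re (cinner x y) + (norm (y::'h::chilbert))\<^sup>2"
  using Re_cinner_commute[of x y] by (simp add: Re_cinner_self[symmetric] cinner_simps)

lemma norm_diff_square:
  "(norm (x - y))\<^sup>2 = (norm x)\<^sup>2 - 2 * Re (cinner x y) + (norm (y::'h::chilbert))\<^sup>2"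
  using norm_add_square[of x "- y"] by (simp add: cinner_simps)

text \<open>Squaring the triangle inequality, which the class provides for its norm, leaves exactly
  the cross term.\<close>

lemma Re_cinner_le: "Re (cinner x y) \<le> norm x * norm (y::'h::chilbert)"
proof -
  have "(norm (x + y))\<^sup>2 \<le> (norm x + norm y)\<^sup>2"
    by (intro power_mono norm_triangle_ineq norm_ge_zero)
  then show ?thesis
    by (simp add: norm_add_square power2_sum)
qed

lemma norm_cinner_le: "cmod (cinner x y) \<le> norm x * norm (y::'h::chilbert)"
proof (cases "cinner x y = 0")
  case False
  \<comment> \<open>A phase of modulus 1 that rotates the inner product onto the positive real axis,
    reducing the claim to real parts.\<close>
  define c where "c = cnj (cinner x y) / cmod (cinner x y)"
  have "cmod c = 1"
    using False by (simp add: c_def norm_divide)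
  have "c * cinner x y = cmod (cinner x y)"
    using False by (simp add: c_def complex_norm_square[symmetric] mult.commute[of "cnj _"] power2_eq_square)
  then have "cmod (cinner x y) = Re (cinner x (cscale c y))"
    by (simp add: cinner_simps)
  also have "\<dots> \<le> norm x * norm (cscale c y)"
    by (rule Re_cinner_le)
  finally show ?thesis
    by (simp add: norm_cscale \<open>cmod c = 1\<close>)
qed simp

lemma bounded_linear_cinner_right: "bounded_linear (cinner (x::'h::chilbert))"
  by (rule bounded_linear_intro[where K = "norm x"])
    (auto simp: cinner_simps scaleR_conv_of_real norm_cinner_le mult.commute[of "norm _" "norm x"])

lemma bounded_linear_Re_cinner_right: "bounded_linear (\<lambda>y. Re (cinner (x::'h::chilbert) y))"
  by (rule bounded_linear_compose[OF bounded_linear_Re bounded_linear_cinner_right])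

lemma Re_cinner_eqI:
  fixes u v :: "'h::chilbert"
  assumes "\<And>x. Re (cinner u x) = Re (cinner v x)"
  shows "u = v"
proof -
  have "(norm (u - v))\<^sup>2 = 0"
    using assms[of "u - v"] by (simp add: Re_cinner_self[symmetric] cinner_simps)
  then show ?thesis by simp
qed

text \<open>Replacing \<open>x\<close> by \<open>cscale \<i> x\<close> trades real for imaginary
  parts. This recovers complex identities from the Riesz lemma below, which speaks of real
  parts.\<close>

lemma cinner_eqI:
  fixes u v :: "'h::chilbert"
  assumes "\<And>x. Re (cinner u x) = Re (cinner v (f x))" and "\<And>x. f (cscale \<i> x) = cscale \<i> (f x)"
  shows "cinner u x = cinner v (f x)"
  using assms(1)[of x] assms(1)[of "cscale \<i> x"]
  by (simp add: assms(2) cinner_simps complex_eq_iff)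

text \<open>The representing vector minimises \<open>J\<close>; the parallelogram law makes minimising sequences Cauchy.\<close>
lemma riesz_representation_subspace:
  fixes f :: "'h::chilbert \<Rightarrow> real"
  assumes K: "subspace K" "closed K" and f: "bounded_linear f"
  obtains u where "u \<in> K" "\<And>y. y \<in> K \<Longrightarrow> Re (cinner u y) = f y"
proof -
  interpret f: bounded_linear f by (rule f)
  define J where "J x = (norm x)\<^sup>2 / 2 - f x" for x
  obtain C where C: "\<And>x. norm (f x) \<le> norm x * C"
    using f.bounded by blast
  have J_lower: "- (C\<^sup>2 / 2) \<le> J x" for x
  proof -
    have "0 \<le> (norm x - C)\<^sup>2" by simp
    moreover have "f x \<le> norm x * C" using C[of x] by simp
    ultimately show ?thesis
      unfolding J_def power2_diff by simp
  qed
  then have bdd: "bdd_below (J ` K)"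
    by (intro bdd_belowI2)
  define m where "m = Inf (J ` K)"
  have m_le: "m \<le> J x" if "x \<in> K" for x
    unfolding m_def using bdd that by (rule cINF_lower)
  have "\<exists>x\<in>K. J x < m + e" if "e > 0" for e
  proof (rule ccontr)
    assume "\<not> ?thesis"
    then have "m + e \<le> Inf (J ` K)"
      using subspace_0[OF K(1)] by (intro cINF_greatest) (auto simp: not_less)
    with that show False unfolding m_def by simp
  qed
  then have "\<exists>x\<in>K. J x < m + 1 / Suc n" for n
    by simp
  then obtain x where x: "\<And>n. x n \<in> K" "\<And>n. J (x n) < m + 1 / Suc n"
    by metis
  have J_mid: "(norm (a - b))\<^sup>2 / 4 = J a + J b - 2 * J (scaleR (1/2) (a + b))" for a b
  proof -
    have half: "(norm (scaleR (1/2) (a + b)))\<^sup>2 = (norm (a + b))\<^sup>2 / 4"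
      "f (scaleR (1/2) (a + b)) = (f a + f b) / 2"
      by (simp_all add: power_divide f.scaleR f.add del: scaleR_add_right)
    show ?thesis
      unfolding J_def half norm_add_square norm_diff_square by (simp add: field_simps)
  qed
  have gap: "(norm (a - b))\<^sup>2 / 4 \<le> J a + J b - 2 * m" if "a \<in> K" "b \<in> K" for a b
    using m_le[of "scaleR (1/2) (a + b)"] K(1) that
    by (simp add: J_mid subspace_scale subspace_add)
  have "Cauchy x"
  proof (rule metric_CauchyI)
    fix e :: real assume e: "e > 0"
    \<comment> \<open>The 8 is the 4 from \<open>gap\<close> times 2 for the two excesses over
      \<open>m\<close>, each below \<open>1 / Suc N\<close>.\<close>
    obtain N where N: "inverse (real (Suc N)) < e\<^sup>2 / 8"
      using reals_Archimedean[of "e\<^sup>2 / 8"] e by auto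
    show "\<exists>M. \<forall>i\<ge>M. \<forall>n\<ge>M. dist (x i) (x n) < e"
    proof (intro exI[of _ N] allI impI)
      fix i n assume "N \<le> i" "N \<le> n"
      then have "1 / real (Suc i) \<le> 1 / real (Suc N)" "1 / real (Suc n) \<le> 1 / real (Suc N)"
        by (simp_all add: frac_le)
      then have "(norm (x i - x n))\<^sup>2 < e\<^sup>2"
        using gap[OF x(1)[of i] x(1)[of n]] x(2)[of i] x(2)[of n] N by (simp add: inverse_eq_divide)
      then show "dist (x i) (x n) < e"
        using e by (simp add: dist_norm power2_less_imp_less)
    qed
  qed
  then obtain u where u: "x \<longlonglongrightarrow> u"
    using Cauchy_convergent_iff convergent_def by blast
  have uK: "u \<in> K"
    using closed_sequentially[OF K(2)] x(1) u by blast
  have "(\<lambda>n. J (x n)) \<longlonglongrightarrow> J u"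
    unfolding J_def by (intro tendsto_intros f.tendsto u) auto
  moreover have "(\<lambda>n. m + 1 / Suc n) \<longlonglongrightarrow> m + 0"
    by (intro tendsto_intros LIMSEQ_inverse_real_of_nat[unfolded inverse_eq_divide])
  ultimately have Ju: "J u \<le> m"
    using x(2) by (intro LIMSEQ_le[of "\<lambda>n. J (x n)" _ "\<lambda>n. m + 1 / Suc n"]) (auto intro: less_imp_le)
  have "Re (cinner u y) = f y" if y: "y \<in> K" for y
  proof -
    \<comment> \<open>These are the quadratic and linear coefficients in \<open>t\<close> of
      \<open>J (u + scaleR t y) - J u\<close>.\<close>
    define a b where "a = (norm y)\<^sup>2 / 2" and "b = Re (cinner u y) - f y"
    have a: "a \<ge> 0" by (simp add: a_def)
    \<comment> \<open>Dividing by \<open>a + 1\<close> covers \<open>y = 0\<close> and makes the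
      increment of \<open>J\<close> equal to \<open>- t\<^sup>2\<close>, which forces
      \<open>t = 0\<close>.\<close>
    define t where "t = - b / (a + 1)"
    have b: "b = - t * (a + 1)" using a by (simp add: t_def)
    have "J u \<le> J (u + scaleR t y)"
      using Ju m_le[of "u + scaleR t y"] K(1) uK y by (simp add: subspace_add subspace_scale)
    then have "0 \<le> t * b + t\<^sup>2 * a"
      by (simp add: J_def norm_add_square f.add f.scaleR cinner_simps a_def b_def
          power_mult_distrib algebra_simps)
    also have "\<dots> = - t\<^sup>2"
      unfolding b by (simp add: algebra_simps power2_eq_square)
    finally show ?thesis
      using b by (simp add: b_def)
  qed
  with uK show ?thesis by (rule that)
qed

section \<open>Bounded operators and von Neumann algebras\<close>

lemma bounded_op_imp_bounded_linear:
  assumes "bounded_op T" shows "bounded_linear T"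
proof -
  obtain K where "\<And>x. norm (T x) \<le> K * norm x"
    using assms by (auto simp: bounded_op_def)
  then show ?thesis
    using assms by (intro bounded_linear_intro[where K = K])
      (auto simp: bounded_op_def cscale_of_real[symmetric] mult.commute)
qed

lemma bounded_opI:
  assumes "\<And>x y. T (x + y) = T x + T y" "\<And>a x. T (cscale a x) = cscale a (T x)"
    "\<And>x. norm (T x) \<le> K * norm x"
  shows "bounded_op T"
  using assms unfolding bounded_op_def by blast

lemma bounded_op_add: "bounded_op T \<Longrightarrow> T (x + y) = T x + T y"
  and bounded_op_cscale: "bounded_op T \<Longrightarrow> T (cscale a x) = cscale a (T x)"
  by (auto simp: bounded_op_def)

lemma bounded_op_zero [simp]: "bounded_op T \<Longrightarrow> T 0 = 0"
  by (metis bounded_op_imp_bounded_linear bounded_linear.linear linear_0)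

lemma bounded_op_diff: "bounded_op T \<Longrightarrow> T (x - y) = T x - T y"
  by (metis bounded_op_add diff_add_cancel add_diff_cancel_right')

lemma norm_bounded_op_le: "bounded_op T \<Longrightarrow> norm (T x) \<le> onorm T * norm x"
  by (intro onorm bounded_op_imp_bounded_linear)

text \<open>\<open>adjoint_op\<close> is a Hilbert choice, so a witness is needed: Riesz on the
  whole space supplies it for real parts, and complex linearity of \<open>T\<close> for the
  rest.\<close>

lemma adjoint_op:
  assumes T: "bounded_op (T :: 'h::chilbert \<Rightarrow> 'h)"
  shows "cinner (T x) y = cinner x (adjoint_op T y)"
proof -
  have "\<exists>u. \<forall>x. cinner (T x) y = cinner x u" for y
  proof -
    have "bounded_linear (\<lambda>x. Re (cinner y (T x)))"
      by (rule bounded_linear_compose[OF bounded_linear_Re_cinner_right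
            bounded_op_imp_bounded_linear[OF T]])
    then obtain u where "\<And>x. Re (cinner u x) = Re (cinner y (T x))"
      using riesz_representation_subspace[of UNIV] by auto
    then have "cinner u x = cinner y (T x)" for x
      by (rule cinner_eqI) (rule bounded_op_cscale[OF T])
    then show ?thesis
      by (metis cinner_conj)
  qed
  then obtain S where "\<forall>y x. cinner (T x) y = cinner x (S y)"
    by metis
  then have "\<exists>S. \<forall>x y. cinner (T x) y = cinner x (S y)"
    by blast
  then have "\<forall>x y. cinner (T x) y = cinner x (adjoint_op T y)"
    unfolding adjoint_op_def by (rule someI_ex)
  then show ?thesis by blast
qed

lemma adjoint_op':
  "bounded_op (T :: 'h::chilbert \<Rightarrow> 'h) \<Longrightarrow> cinner x (T y) = cinner (adjoint_op T x) y"
  by (metis adjoint_op cinner_conj)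

lemma bounded_op_adjoint:
  assumes T: "bounded_op (T :: 'h::chilbert \<Rightarrow> 'h)"
  shows "bounded_op (adjoint_op T)"
proof (rule bounded_opI[where K = "onorm T"])
  show "adjoint_op T (x + y) = adjoint_op T x + adjoint_op T y" for x y
    by (rule Re_cinner_eqI) (simp add: adjoint_op'[OF T, symmetric] cinner_simps)
  show "adjoint_op T (cscale a x) = cscale a (adjoint_op T x)" for a x
    by (rule Re_cinner_eqI) (simp only: adjoint_op'[OF T, symmetric] cinner_simps)
  show "norm (adjoint_op T x) \<le> onorm T * norm x" for x
  proof (cases "adjoint_op T x = 0")
    case True
    then show ?thesis
      using onorm_pos_le[OF bounded_op_imp_bounded_linear[OF T]] by simp
  next
    case False
    have "(norm (adjoint_op T x))\<^sup>2 = Re (cinner (T (adjoint_op T x)) x)"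
      by (simp add: adjoint_op[OF T] Re_cinner_self)
    also have "\<dots> \<le> norm (T (adjoint_op T x)) * norm x"
      by (rule Re_cinner_le)
    also have "\<dots> \<le> (onorm T * norm (adjoint_op T x)) * norm x"
      by (intro mult_right_mono norm_bounded_op_le T norm_ge_zero)
    finally show ?thesis
      using False by (simp add: power2_eq_square)
  qed
qed

section \<open>Sums and compositions of bounded operators\<close>

lemma bounded_op_id: "bounded_op (\<lambda>x. x)"
  by (rule bounded_opI[where K = 1]) auto

lemma bounded_op_cscale_id: "bounded_op (cscale c)"
  by (rule bounded_opI[where K = "cmod c"])
    (auto simp: cscale_add_right cscale_cscale norm_cscale mult.commute)

lemma bounded_op_comp:
  assumes "bounded_op S" "bounded_op T"
  shows "bounded_op (\<lambda>x. S (T x))"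
  using bounded_linear.bounded[OF bounded_linear_compose[OF assms[THEN bounded_op_imp_bounded_linear]]]
  using assms by (auto simp: bounded_op_def mult.commute)

lemma bounded_op_sum:
  assumes S: "bounded_op S" and T: "bounded_op T"
  shows "bounded_op (\<lambda>x. S x + T x)"
proof (rule bounded_opI[where K = "onorm S + onorm T"])
  show "norm (S x + T x) \<le> (onorm S + onorm T) * norm x" for x
    using norm_triangle_ineq[of "S x" "T x"] norm_bounded_op_le[OF S, of x] norm_bounded_op_le[OF T, of x]
    by (simp add: distrib_right)
qed (use S T in \<open>simp_all add: bounded_op_add bounded_op_cscale cscale_add_right\<close>)

section \<open>Commutants\<close>

lemma commutant_comp:
  "S \<in> commutant M \<Longrightarrow> T \<in> commutant M \<Longrightarrow> (\<lambda>x. S (T x)) \<in> commutant M"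
  by (auto simp: commutant_def bounded_op_comp fun_eq_iff)

lemma commutant_commute: "T \<in> commutant M \<Longrightarrow> A \<in> M \<Longrightarrow> T (A x) = A (T x)"
  by (auto simp: commutant_def fun_eq_iff)

lemma commutant_add:
  assumes "M \<subseteq> Collect bounded_op" "S \<in> commutant M" "T \<in> commutant M"
  shows "(\<lambda>x. S x + T x) \<in> commutant M"
  using assms by (auto simp: commutant_def bounded_op_sum fun_eq_iff bounded_op_add)

lemma cscale_id_in_commutant: "M \<subseteq> Collect bounded_op \<Longrightarrow> cscale c \<in> commutant M"
  by (auto simp: commutant_def bounded_op_cscale_id bounded_op_cscale fun_eq_iff)

text \<open>Take adjoints in the commutation of \<open>T\<close> with \<open>adjoint_op A\<close>,
  which again lies in \<open>M\<close>.\<close>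

lemma commutant_adjoint:
  fixes M :: "('h::chilbert \<Rightarrow> 'h) set"
  assumes M: "M \<subseteq> Collect bounded_op" "\<And>A. A \<in> M \<Longrightarrow> adjoint_op A \<in> M"
    and T: "T \<in> commutant M"
  shows "adjoint_op T \<in> commutant M"
proof -
  have bT: "bounded_op T" using T by (simp add: commutant_def)
  have "adjoint_op T (A x) = A (adjoint_op T x)" if A: "A \<in> M" for A x
  proof (rule Re_cinner_eqI)
    fix y
    have bA: "bounded_op A" using A M by auto
    have "cinner (A (adjoint_op T x)) y = cinner x (T (adjoint_op A y))"
      by (simp add: adjoint_op[OF bA] adjoint_op'[OF bT])
    also have "\<dots> = cinner x (adjoint_op A (T y))"
      by (simp add: commutant_commute[OF T M(2)[OF A]])
    also have "\<dots> = cinner (adjoint_op T (A x)) y"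
      by (simp add: adjoint_op[OF bA, symmetric] adjoint_op'[OF bT])
    finally show "Re (cinner (adjoint_op T (A x)) y) = Re (cinner (A (adjoint_op T x)) y)"
      by simp
  qed
  then show ?thesis
    using bounded_op_adjoint[OF bT] by (auto simp: commutant_def fun_eq_iff)
qed

section \<open>Algebraic operations in a von Neumann algebra\<close>

context
  fixes M :: "('h::chilbert \<Rightarrow> 'h) set"
  assumes vn: "von_neumann_algebra M"
begin

lemma vna_bounded_op: "A \<in> M \<Longrightarrow> bounded_op A"
  using vn by (auto simp: von_neumann_algebra_def)

lemma vna_adjoint: "A \<in> M \<Longrightarrow> adjoint_op A \<in> M"
  using vn by (auto simp: von_neumann_algebra_def)

lemma commutant_bounded_op: "commutant M \<subseteq> Collect bounded_op"
  by (auto simp: commutant_def)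

lemma vna_bicommutant: "commutant (commutant M) = M"
  using vn by (auto simp: von_neumann_algebra_def)

text \<open>\<open>M\<close> is itself a commutant, so the closure properties of commutants apply to
  it.\<close>

lemma vna_comp: "S \<in> M \<Longrightarrow> T \<in> M \<Longrightarrow> (\<lambda>x. S (T x)) \<in> M"
  using commutant_comp[of S "commutant M" T] by (simp add: vna_bicommutant)

lemma vna_add: "S \<in> M \<Longrightarrow> T \<in> M \<Longrightarrow> (\<lambda>x. S x + T x) \<in> M"
  using commutant_add[OF commutant_bounded_op, of S T] by (simp add: vna_bicommutant)

lemma vna_cscale_id: "cscale c \<in> M"
  using cscale_id_in_commutant[OF commutant_bounded_op] by (simp add: vna_bicommutant)

lemma vna_id: "(\<lambda>x. x) \<in> M"
  using vna_cscale_id[of 1] by (simp add: cscale_one[abs_def])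

lemma vna_cscale: "A \<in> M \<Longrightarrow> (\<lambda>x. cscale c (A x)) \<in> M"
  by (rule vna_comp[OF vna_cscale_id])

lemma vna_diff:
  assumes "S \<in> M" "T \<in> M" shows "(\<lambda>x. S x - T x) \<in> M"
  using vna_add[OF assms(1) vna_cscale[OF assms(2), of "-1"]] by (simp add: cscale_minus_one)

lemma vna_zero: "(\<lambda>x. 0) \<in> M"
  using vna_diff[OF vna_id vna_id] by simp

end

text \<open>The orthogonal projection onto \<open>K\<close> commutes with the commutant, because
  \<open>K\<close> is invariant under it and it is closed under adjoints; so the projection lies in
  the bicommutant.\<close>

lemma vna_projection:
  fixes M :: "('h::chilbert \<Rightarrow> 'h) set"
  assumes vn: "von_neumann_algebra M" and K: "subspace K" "closed K"
    and inv: "\<And>T k. T \<in> commutant M \<Longrightarrow> k \<in> K \<Longrightarrow> T k \<in> K"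
  obtains p where "p \<in> M" "\<And>x. p x \<in> K" "\<And>k. k \<in> K \<Longrightarrow> p k = k"
    "\<And>x y. cinner (p x) y = cinner x (p y)" "\<And>x. norm (p x) \<le> norm x"
proof -
  have "\<exists>u. u \<in> K \<and> (\<forall>k\<in>K. Re (cinner u k) = Re (cinner x k))" for x
    using riesz_representation_subspace[OF K bounded_linear_Re_cinner_right] by metis
  then obtain p where pK: "\<And>x. p x \<in> K"
    and p: "\<And>x k. k \<in> K \<Longrightarrow> Re (cinner (p x) k) = Re (cinner x k)"
    by metis
  \<comment> \<open>Each algebraic identity for \<open>p\<close> is then proved by checking that the
    candidate value has the defining property.\<close>
  have p_unique: "p x = u" if "u \<in> K" "\<And>k. k \<in> K \<Longrightarrow> Re (cinner u k) = Re (cinner x k)" for x u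
  proof -
    have "p x - u \<in> K"
      using K(1) pK that(1) by (rule subspace_diff)
    then have "(norm (p x - u))\<^sup>2 = 0"
      using p[of "p x - u" x] that(2)[of "p x - u"]
      by (simp add: Re_cinner_self[symmetric] cinner_diff_left)
    then show ?thesis by simp
  qed
  have commute: "p (T x) = T (p x)" if T: "T \<in> commutant M" for T x
  proof (rule p_unique)
    have bT: "bounded_op T"
      using T by (simp add: commutant_def)
    have adj: "adjoint_op T \<in> commutant M"
      using vn T by (intro commutant_adjoint) (auto simp: von_neumann_algebra_def)
    show "T (p x) \<in> K"
      by (rule inv[OF T pK])
    show "Re (cinner (T (p x)) k) = Re (cinner (T x) k)" if "k \<in> K" for k
      using p[OF inv[OF adj that], of x] by (simp add: adjoint_op[OF bT])
  qed
  \<comment> \<open>Scalars lie in the commutant, so complex homogeneity is a case of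
    \<open>commute\<close>, although \<open>subspace\<close> concerns real scalars only.\<close>
  have cscale: "p (cscale c x) = cscale c (p x)" for c x
    using vn by (intro commute cscale_id_in_commutant) (simp add: von_neumann_algebra_def)
  have contractive: "norm (p x) \<le> norm x" for x
  proof (cases "p x = 0")
    case False
    have "(norm (p x))\<^sup>2 \<le> norm x * norm (p x)"
      using p[OF pK, of x x] Re_cinner_le[of x "p x"] by (simp add: Re_cinner_self)
    with False show ?thesis
      by (simp add: power2_eq_square)
  qed simp
  have "bounded_op p"
  proof (rule bounded_opI[where K = 1])
    show "p (x + y) = p x + p y" for x y
      by (rule p_unique) (auto simp: subspace_add[OF K(1)] pK p cinner_simps)
  qed (auto simp: cscale contractive)
  then have "p \<in> commutant (commutant M)"
    by (auto simp: commutant_def[of "commutant M"] fun_eq_iff commute)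
  moreover have "p k = k" if "k \<in> K" for k
    using that by (rule p_unique) simp
  moreover have "cinner (p x) y = cinner x (p y)" for x y
  proof (rule cinner_eqI)
    show "Re (cinner (p x) y) = Re (cinner x (p y))" for y
      using p[OF pK, of x y] p[OF pK, of y x] by (metis Re_cinner_commute)
  qed (rule cscale)
  ultimately show ?thesis
    using that pK contractive vn by (simp add: vna_bicommutant)
qed

section \<open>The sigma-weak topology\<close>

text \<open>Each subbasic neighbourhood of zero only constrains an operator on the vectors \<open>\<eta> n\<close>.\<close>
lemma sigma_weak_nhd_zero_countable:
  assumes "openin sigma_weak_topology W" "(\<lambda>x::'h::chilbert. 0) \<in> W"
  shows "\<exists>S. countable S \<and> (\<forall>B. (\<forall>v\<in>S. B v = 0) \<longrightarrow> B \<in> W)"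
  using openin_topology_generated_by[OF assms(1)[unfolded sigma_weak_topology_def]] assms(2)
proof (induction rule: generate_topology_on.induct)
  case (Int a b)
  then obtain S T where "countable S" "countable T"
    "\<forall>B. (\<forall>v\<in>S. B v = 0) \<longrightarrow> B \<in> a" "\<forall>B. (\<forall>v\<in>T. B v = 0) \<longrightarrow> B \<in> b"
    by auto
  then show ?case
    by (intro exI[of _ "S \<union> T"]) auto
next
  case (UN \<K>)
  then show ?case by (meson Union_iff)
next
  case (Basis s)
  then obtain \<xi> \<eta> U where s: "s = {A. sw_functional \<xi> \<eta> A \<in> U}" by blast
  with Basis(2) have "0 \<in> U"
    by (simp add: sw_functional_def)
  with s show ?case
    by (intro exI[of _ "range \<eta>"]) (simp add: sw_functional_def)
qed simp

text \<open>Convergence passes from subbasic sets to finite intersections and unions.\<close>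

lemma limitin_sigma_weak:
  fixes L :: "'h::chilbert \<Rightarrow> 'h"
  assumes "\<And>\<xi> \<eta>. summable (\<lambda>n. (norm (\<xi> n))\<^sup>2) \<Longrightarrow> summable (\<lambda>n. (norm (\<eta> n))\<^sup>2)
      \<Longrightarrow> ((\<lambda>s. sw_functional \<xi> \<eta> (Y s)) \<longlongrightarrow> sw_functional \<xi> \<eta> L) F"
  shows "limitin sigma_weak_topology Y L F"
  unfolding limitin_def
proof (intro conjI allI impI; (elim conjE)?)
  \<comment> \<open>Zero sequences with \<open>U = UNIV\<close> give a subbasic set that is the
    whole space.\<close>
  let ?z = "\<lambda>n::nat. 0::'h"
  show "L \<in> topspace sigma_weak_topology"
    unfolding sigma_weak_topology_def topology_generated_by_topspace
    by (rule UnionI[of "{A. sw_functional ?z ?z A \<in> UNIV}"]) (force intro: exI[of _ ?z])+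
next
  fix W assume W: "openin sigma_weak_topology W" and L: "L \<in> W"
  show "\<forall>\<^sub>F s in F. Y s \<in> W"
    using openin_topology_generated_by[OF W[unfolded sigma_weak_topology_def]] L
  proof (induction rule: generate_topology_on.induct)
    case (Int a b)
    then show ?case by (auto simp: eventually_conj_iff)
  next
    case (UN \<K>)
    then obtain k where "k \<in> \<K>" "\<forall>\<^sub>F s in F. Y s \<in> k" by auto
    then show ?case by (auto elim: eventually_mono)
  next
    case (Basis s)
    then obtain \<xi> \<eta> U where s: "s = {A. sw_functional \<xi> \<eta> A \<in> U}" "open U"
      and "summable (\<lambda>n. (norm (\<xi> n))\<^sup>2)" "summable (\<lambda>n. (norm (\<eta> n))\<^sup>2)"
      by blast
    then show ?case
      using topological_tendstoD[OF assms] Basis(2) by simp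
  qed simp
qed

text \<open>A vector functional is an \<open>sw_functional\<close> of sequences supported at index
  0.\<close>

lemma continuous_map_vector_functional:
  fixes \<xi> \<eta> :: "'h::chilbert"
  shows "continuous_map sigma_weak_topology euclidean (\<lambda>B. cinner \<xi> (B \<eta>))"
proof -
  define x where "x = (\<lambda>n::nat. if n = 0 then \<xi> else 0)"
  define y where "y = (\<lambda>n::nat. if n = 0 then \<eta> else 0)"
  have sw: "sw_functional x y B = cinner \<xi> (B \<eta>)" for B
  proof -
    have "(\<lambda>n. if n = 0 then cinner \<xi> (B \<eta>) else 0) sums cinner \<xi> (B \<eta>)"
      by (rule sums_single)
    moreover have "(\<lambda>n. if n = 0 then cinner \<xi> (B \<eta>) else 0) = (\<lambda>n. cinner (x n) (B (y n)))"
      by (auto simp: x_def y_def)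
    ultimately show ?thesis
      unfolding sw_functional_def by (simp add: sums_iff)
  qed
  have summable: "summable (\<lambda>n. (norm (x n))\<^sup>2)" "summable (\<lambda>n. (norm (y n))\<^sup>2)"
    by (rule summable_finite[of "{0}"]; simp add: x_def y_def)+
  have "openin sigma_weak_topology {B. cinner \<xi> (B \<eta>) \<in> U}" if "open U" for U
    unfolding sigma_weak_topology_def sw[symmetric]
    by (rule topology_generated_by_Basis) (use summable that in blast)
  moreover from this[of UNIV] have "topspace (sigma_weak_topology :: ('h \<Rightarrow> 'h) topology) = UNIV"
    using openin_subset[of sigma_weak_topology "UNIV :: ('h \<Rightarrow> 'h) set"] by (simp add: top.extremum_unique)
  ultimately show ?thesis
    by (simp add: continuous_map_def)
qed

lemma normal_functional_vector:
  "normal_functional M (\<lambda>B. cinner \<xi> (B (\<eta>::'h::chilbert)))"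
  unfolding normal_functional_def
  by (auto simp: cinner_simps intro: continuous_map_from_subtopology continuous_map_vector_functional)

section \<open>Normal completely positive contractions\<close>

context
  fixes M :: "('h::chilbert \<Rightarrow> 'h) set" and \<Phi>
  assumes vn: "von_neumann_algebra M" and cp: "normal_cp_contraction M \<Phi>"
begin

lemma ncp_in: "A \<in> M \<Longrightarrow> \<Phi> A \<in> M"
  and ncp_add: "A \<in> M \<Longrightarrow> B \<in> M \<Longrightarrow> \<Phi> (\<lambda>x. A x + B x) = (\<lambda>x. \<Phi> A x + \<Phi> B x)"
  and ncp_cscale: "A \<in> M \<Longrightarrow> \<Phi> (\<lambda>x. cscale c (A x)) = (\<lambda>x. cscale c (\<Phi> A x))"
  and ncp_onorm: "A \<in> M \<Longrightarrow> onorm (\<Phi> A) \<le> onorm A"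
  and ncp_continuous: "continuous_map (subtopology sigma_weak_topology M) sigma_weak_topology \<Phi>"
  and ncp_cp: "completely_positive M \<Phi>"
  using cp by (auto simp: normal_cp_contraction_def)

lemma ncp_diff:
  assumes "A \<in> M" "B \<in> M" shows "\<Phi> (\<lambda>x. A x - B x) = (\<lambda>x. \<Phi> A x - \<Phi> B x)"
  using ncp_add[OF assms(1) vna_cscale[OF vn assms(2), of "-1"]] ncp_cscale[OF assms(2), of "-1"]
  by (simp add: cscale_minus_one)

lemma ncp_zero: "\<Phi> (\<lambda>x. 0) = (\<lambda>x. 0)"
  using ncp_diff[OF vna_zero[OF vn] vna_zero[OF vn]] by simp

lemma ncp_norm_le:
  assumes "A \<in> M" shows "norm (\<Phi> A x) \<le> onorm A * norm x"
  using norm_bounded_op_le[OF vna_bounded_op[OF vn ncp_in[OF assms]], of x]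
    mult_right_mono[OF ncp_onorm[OF assms] norm_ge_zero, of x] by linarith

lemma ncp_positive:
  assumes "B \<in> M" "\<And>v. Im (cinner v (B v)) = 0" "\<And>v. Re (cinner v (B v)) \<ge> 0"
  shows "Re (cinner v (\<Phi> B v)) \<ge> 0"
proof -
  have "positive_op_matrix 1 (\<lambda>i j. \<Phi> B)"
    using ncp_cp[unfolded completely_positive_def, rule_format, of 1 "\<lambda>i j. B"] assms
    by (simp add: positive_op_matrix_def)
  then show ?thesis
    unfolding positive_op_matrix_def Let_def by (auto dest: spec[of _ "\<lambda>_. v"])
qed

text \<open>Positivity of the image of \<open>((1, X), (X*, X*X))\<close>, tested on \<open>(- \<Phi> X \<xi>, \<xi>)\<close>.\<close>
lemma kadison_schwarz:
  assumes X: "X \<in> M"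
  shows "(norm (\<Phi> X \<xi>))\<^sup>2 \<le> Re (cinner \<xi> (\<Phi> (\<lambda>x. adjoint_op X (X x)) \<xi>))"
proof -
  note bX = vna_bounded_op[OF vn X]
  define Y where "Y = adjoint_op X"
  define Z where "Z = (\<lambda>x. Y (X x))"
  have YM: "Y \<in> M"
    unfolding Y_def by (rule vna_adjoint[OF vn X])
  have ZM: "Z \<in> M"
    unfolding Z_def by (rule vna_comp[OF vn YM X])
  define D :: "nat \<Rightarrow> nat \<Rightarrow> 'h \<Rightarrow> 'h" where
    "D i j = (if i = 0 then if j = 0 then (\<lambda>x. x) else X else if j = 0 then Y else Z)" for i j
  have sum2: "(\<Sum>i<2. \<Sum>j<2. cinner (\<zeta> i) (f (D i j) (\<zeta> j)))
      = cinner (\<zeta> 0) (f (\<lambda>x. x) (\<zeta> 0)) + cinner (\<zeta> 0) (f X (\<zeta> 1))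
        + cinner (\<zeta> 1) (f Y (\<zeta> 0)) + cinner (\<zeta> 1) (f Z (\<zeta> 1))"
    for \<zeta> and f :: "('h \<Rightarrow> 'h) \<Rightarrow> ('h \<Rightarrow> 'h)"
    by (simp add: numeral_2_eq_2 D_def)
  have "positive_op_matrix 2 D"
    unfolding positive_op_matrix_def Let_def
  proof
    fix \<zeta> :: "nat \<Rightarrow> 'h"
    \<comment> \<open>The matrix is \<open>R*R\<close> for the row
      \<open>R = (1, X)\<close>.\<close>
    have "(\<Sum>i<2. \<Sum>j<2. cinner (\<zeta> i) (D i j (\<zeta> j))) = cinner (\<zeta> 0 + X (\<zeta> 1)) (\<zeta> 0 + X (\<zeta> 1))"
      using sum2[of \<zeta> "\<lambda>f. f"]
      by (simp add: cinner_simps adjoint_op[OF bX] Z_def Y_def)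
    then show "Im (\<Sum>i<2. \<Sum>j<2. cinner (\<zeta> i) (D i j (\<zeta> j))) = 0
        \<and> 0 \<le> Re (\<Sum>i<2. \<Sum>j<2. cinner (\<zeta> i) (D i j (\<zeta> j)))"
      by (simp add: cinner_self del: of_real_power)
  qed
  moreover have "\<forall>i<2. \<forall>j<2. D i j \<in> M"
    using X YM ZM vna_id[OF vn] by (auto simp: D_def)
  ultimately have "positive_op_matrix 2 (\<lambda>i j. \<Phi> (D i j))"
    using ncp_cp by (simp add: completely_positive_def)
  then have "\<forall>\<zeta>. Im (\<Sum>i<2. \<Sum>j<2. cinner (\<zeta> i) (\<Phi> (D i j) (\<zeta> j))) = 0
      \<and> 0 \<le> Re (\<Sum>i<2. \<Sum>j<2. cinner (\<zeta> i) (\<Phi> (D i j) (\<zeta> j)))"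
    unfolding positive_op_matrix_def Let_def .
  note this[unfolded sum2[of _ \<Phi>], rule_format]
  from this[of "\<lambda>i. if i = 0 then _ else _"]
  have pos: "Im (cinner a (\<Phi> (\<lambda>x. x) a) + cinner a (\<Phi> X b) + cinner b (\<Phi> Y a) + cinner b (\<Phi> Z b)) = 0
      \<and> 0 \<le> Re (cinner a (\<Phi> (\<lambda>x. x) a) + cinner a (\<Phi> X b) + cinner b (\<Phi> Y a) + cinner b (\<Phi> Z b))" for a b
    by simp
  note b\<Phi> = vna_bounded_op[OF vn ncp_in]
  have [simp]: "\<Phi> (\<lambda>x. x) 0 = 0" "\<Phi> X 0 = 0" "\<Phi> Y 0 = 0" "\<Phi> Z 0 = 0"
    using b\<Phi> X YM ZM vna_id[OF vn] by simp_all
  define a where "a = - \<Phi> X \<xi>"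
  \<comment> \<open>It has not been shown that \<open>\<Phi> Y\<close> is the adjoint of
    \<open>\<Phi> X\<close>. Reality of the form at \<open>(cscale \<i> a, \<xi>)\<close> gives
    instead that the two cross terms have equal real part.\<close>
  have "Im (cinner (cscale \<i> a) (\<Phi> (\<lambda>x. x) (cscale \<i> a))) = 0" "Im (cinner \<xi> (\<Phi> Z \<xi>)) = 0"
    using pos[of "cscale \<i> a" 0] pos[of 0 \<xi>] by simp_all
  then have "Re (cinner a (\<Phi> X \<xi>)) = Re (cinner \<xi> (\<Phi> Y a))"
    using pos[of "cscale \<i> a" \<xi>] bounded_op_cscale[OF b\<Phi>[OF YM]] by (simp add: cinner_simps)
  moreover have "Re (cinner a (\<Phi> (\<lambda>x. x) a)) \<le> (norm a)\<^sup>2"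
  proof -
    have "onorm (\<lambda>x::'h. x) \<le> 1"
      by (rule onorm_bound) auto
    then have "norm (\<Phi> (\<lambda>x. x) a) \<le> 1 * norm a"
      using ncp_norm_le[OF vna_id[OF vn], of a] mult_right_mono[OF _ norm_ge_zero, of _ 1 a]
      by fastforce
    then have "norm a * norm (\<Phi> (\<lambda>x. x) a) \<le> norm a * norm a"
      by (intro mult_left_mono) auto
    then show ?thesis
      using Re_cinner_le[of a "\<Phi> (\<lambda>x. x) a"] by (simp add: power2_eq_square)
  qed
  moreover have "Re (cinner a (\<Phi> X \<xi>)) = - (norm (\<Phi> X \<xi>))\<^sup>2" "norm a = norm (\<Phi> X \<xi>)"
    by (simp_all add: a_def cinner_simps Re_cinner_self)
  \<comment> \<open>Each cross term contributes minus the squared norm of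
    \<open>\<Phi> X \<xi>\<close>, and the first term at most its square; positivity leaves the
    claim.\<close>
  ultimately show ?thesis
    using pos[of a \<xi>] by (simp add: Z_def Y_def)
qed

text \<open>The operators \<open>(Y s)*(Y s)\<close> tend to 0 sigma-weakly, so normality applies to
  them, and the Kadison-Schwarz inequality returns to \<open>Y s\<close>.\<close>

lemma ncp_bounded_strong_tendsto_zero:
  assumes Y: "\<And>s. Y s \<in> M" and bound: "\<And>s v. norm (Y s v) \<le> C * norm v"
    and lim: "\<And>v. ((\<lambda>s. Y s v) \<longlongrightarrow> 0) F"
  shows "((\<lambda>s. \<Phi> (Y s) \<xi>) \<longlongrightarrow> 0) F"
proof (cases "F = bot")
  case False
  define W where "W s = (\<lambda>x. adjoint_op (Y s) (Y s x))" for s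
  have WM: "W s \<in> M" for s
    unfolding W_def by (rule vna_comp[OF vn vna_adjoint[OF vn Y] Y])
  have "limitin sigma_weak_topology W (\<lambda>x. 0) F"
  proof (rule limitin_sigma_weak)
    fix x y :: "nat \<Rightarrow> 'h"
    assume sum: "summable (\<lambda>n. (norm (x n))\<^sup>2)" "summable (\<lambda>n. (norm (y n))\<^sup>2)"
    have W: "cinner u (W s v) = cinner (Y s u) (Y s v)" for u v s
      by (simp add: W_def adjoint_op[OF vna_bounded_op[OF vn Y]])
    \<comment> \<open>A summable majorant independent of \<open>s\<close>, for dominated convergence
      of the series.\<close>
    have dom: "norm (cinner (x k) (W s (y k))) \<le> C\<^sup>2 * ((norm (x k))\<^sup>2 + (norm (y k))\<^sup>2)" for k s
    proof -
      have "norm (cinner (x k) (W s (y k))) \<le> norm (Y s (x k)) * norm (Y s (y k))"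
        unfolding W by (rule norm_cinner_le)
      also have "\<dots> \<le> (C * norm (x k)) * (C * norm (y k))"
        by (intro mult_mono bound) (auto intro: order_trans[OF norm_ge_zero bound])
      also have "\<dots> = C\<^sup>2 * (norm (x k) * norm (y k))"
        by (simp add: power2_eq_square)
      also have "norm (x k) * norm (y k) \<le> (norm (x k))\<^sup>2 + (norm (y k))\<^sup>2"
        using sum_squares_bound[of "norm (x k)" "norm (y k)"]
          mult_nonneg_nonneg[OF norm_ge_zero[of "x k"] norm_ge_zero[of "y k"]] by linarith
      finally show ?thesis
        by (simp add: mult_left_mono)
    qed
    have "((\<lambda>s. \<Sum>k. cinner (x k) (W s (y k))) \<longlongrightarrow> (\<Sum>k. 0)) F"
    proof (rule tannerys_theorem[THEN conjunct2, THEN conjunct2])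
      show "((\<lambda>s. cinner (x k) (W s (y k))) \<longlongrightarrow> 0) F" for k
      proof (rule Lim_null_comparison)
        show "\<forall>\<^sub>F s in F. norm (cinner (x k) (W s (y k))) \<le> norm (Y s (x k)) * norm (Y s (y k))"
          unfolding W by (intro always_eventually allI norm_cinner_le)
        show "((\<lambda>s. norm (Y s (x k)) * norm (Y s (y k))) \<longlongrightarrow> 0) F"
          using tendsto_mult[OF tendsto_norm_zero[OF lim] tendsto_norm_zero[OF lim]] by simp
      qed
      show "\<forall>\<^sub>F (k, s) in sequentially \<times>\<^sub>F F.
          norm (cinner (x k) (W s (y k))) \<le> C\<^sup>2 * ((norm (x k))\<^sup>2 + (norm (y k))\<^sup>2)"
        using dom by (auto intro: always_eventually)
      show "summable (\<lambda>k. C\<^sup>2 * ((norm (x k))\<^sup>2 + (norm (y k))\<^sup>2))"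
        by (intro summable_mult summable_add sum)
    qed (rule False)
    then show "((\<lambda>s. sw_functional x y (W s)) \<longlongrightarrow> sw_functional x y (\<lambda>x. 0)) F"
      by (simp add: sw_functional_def)
  qed
  then have "limitin (subtopology sigma_weak_topology M) W (\<lambda>x. 0) F"
    by (simp add: limitin_subtopology WM vna_zero[OF vn])
  from continuous_map_limit[OF continuous_map_vector_functional continuous_map_limit[OF ncp_continuous this]]
  have "((\<lambda>s. cinner \<xi> (\<Phi> (W s) \<xi>)) \<longlongrightarrow> 0) F"
    by (simp add: ncp_zero comp_def)
  then have "((\<lambda>s. Re (cinner \<xi> (\<Phi> (W s) \<xi>))) \<longlongrightarrow> 0) F"
    using tendsto_Re by fastforce
  then have "((\<lambda>s. (norm (\<Phi> (Y s) \<xi>))\<^sup>2) \<longlongrightarrow> 0) F"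
    by (rule Lim_null_comparison[rotated])
      (auto simp: W_def intro!: always_eventually kadison_schwarz Y)
  then show ?thesis
    using tendsto_real_sqrt[of "\<lambda>s. (norm (\<Phi> (Y s) \<xi>))\<^sup>2" 0 F] by (simp add: tendsto_norm_zero_iff)
qed simp

text \<open>Operators in \<open>M\<close> vanishing on a suitable countable \<open>S\<close> lie in
  a neighbourhood of 0 where the functional has modulus below 1. So do all their multiples, hence
  the functional kills them.\<close>

lemma ncp_kernel_countable:
  "\<exists>S. countable S \<and> (\<forall>B\<in>M. (\<forall>v\<in>S. B v = 0) \<longrightarrow> cinner \<xi> (\<Phi> B \<xi>) = 0)"
proof -
  have "continuous_map (subtopology sigma_weak_topology M) euclidean ((\<lambda>B. cinner \<xi> (B \<xi>)) \<circ> \<Phi>)"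
    by (rule continuous_map_compose[OF ncp_continuous continuous_map_vector_functional])
  from openin_continuous_map_preimage[OF this, of "ball 0 1"]
  have "openin (subtopology sigma_weak_topology M)
      {B \<in> topspace (subtopology sigma_weak_topology M). cinner \<xi> (\<Phi> B \<xi>) \<in> ball 0 1}"
    by (simp add: comp_def)
  then obtain W where W: "openin sigma_weak_topology W"
    "{B \<in> topspace (subtopology sigma_weak_topology M). cinner \<xi> (\<Phi> B \<xi>) \<in> ball 0 1} = W \<inter> M"
    by (auto simp: openin_subtopology)
  \<comment> \<open>Along the filter \<open>bot\<close> the convergence hypotheses hold trivially,
    so only membership in the topspace is extracted.\<close>
  have "(\<lambda>x. 0) \<in> topspace (subtopology sigma_weak_topology M)"
    using limitin_topspace[OF limitin_sigma_weak[of "\<lambda>_. \<lambda>x::'h. 0" "\<lambda>x. 0" "bot::nat filter"]]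
    by (simp add: vna_zero[OF vn])
  then have "(\<lambda>x. 0) \<in> W \<inter> M"
    unfolding W(2)[symmetric] by (simp add: ncp_zero)
  then have "(\<lambda>x. 0) \<in> W" ..
  then obtain S where S: "countable S" "\<And>B. (\<forall>v\<in>S. B v = 0) \<Longrightarrow> B \<in> W"
    using sigma_weak_nhd_zero_countable[OF W(1)] by blast
  have "cinner \<xi> (\<Phi> B \<xi>) = 0" if B: "B \<in> M" "\<forall>v\<in>S. B v = 0" for B
  proof (rule ccontr)
    assume nz: "cinner \<xi> (\<Phi> B \<xi>) \<noteq> 0"
    \<comment> \<open>Scales the value to 1, just outside the open unit ball.\<close>
    define c where "c = inverse (cinner \<xi> (\<Phi> B \<xi>))"
    have "(\<lambda>x. cscale c (B x)) \<in> W \<inter> M"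
      using B by (simp add: S(2) vna_cscale[OF vn])
    then have "cinner \<xi> (\<Phi> (\<lambda>x. cscale c (B x)) \<xi>) \<in> ball 0 1"
      unfolding W(2)[symmetric] by simp
    then show False
      using nz by (simp add: ncp_cscale[OF B(1)] cinner_simps c_def)
  qed
  with S(1) show ?thesis by blast
qed

text \<open>With \<open>q = 1 - p\<close>, the Kadison--Schwarz inequality and \<open>(Xq)*(Xq) \<le> c\<^sup>2 q\<close> kill \<open>\<Phi> (Xq) \<xi>\<close>.\<close>
lemma ncp_cut_down:
  assumes p: "p \<in> M" "\<And>x y. cinner (p x) y = cinner x (p y)"
    "\<And>x. p (p x) = p x" and null: "cinner \<xi> (\<Phi> (\<lambda>x. x - p x) \<xi>) = 0" and X: "X \<in> M"
  shows "\<Phi> X \<xi> = \<Phi> (\<lambda>x. X (p x)) \<xi>"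
proof -
  define q where "q = (\<lambda>x. x - p x)"
  have q: "q \<in> M"
    unfolding q_def by (rule vna_diff[OF vn vna_id[OF vn] p(1)])
  have qq: "cinner v (q v) = of_real ((norm (q v))\<^sup>2)" for v
    unfolding cinner_self[symmetric] by (simp add: q_def cinner_simps p)
  define Y where "Y = (\<lambda>x. X (q x))"
  have Y: "Y \<in> M"
    unfolding Y_def by (rule vna_comp[OF vn X q])
  define Z where "Z = (\<lambda>x. adjoint_op Y (Y x))"
  have Z: "Z \<in> M"
    unfolding Z_def by (rule vna_comp[OF vn vna_adjoint[OF vn Y] Y])
  have ZY: "cinner v (Z v) = of_real ((norm (Y v))\<^sup>2)" for v
    by (simp add: Z_def adjoint_op[OF vna_bounded_op[OF vn Y], symmetric] cinner_self)
  define c where "c = onorm X"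
  define P where "P = (\<lambda>x. cscale (of_real (c\<^sup>2)) (q x) - Z x)"
  have qc: "(\<lambda>x. cscale (of_real (c\<^sup>2)) (q x)) \<in> M"
    by (rule vna_cscale[OF vn q])
  have "P \<in> M"
    unfolding P_def by (rule vna_diff[OF vn qc Z])
  moreover have P: "cinner v (P v) = of_real (c\<^sup>2 * (norm (q v))\<^sup>2 - (norm (Y v))\<^sup>2)" for v
    by (simp add: P_def cinner_simps qq ZY)
  moreover have "(norm (Y v))\<^sup>2 \<le> c\<^sup>2 * (norm (q v))\<^sup>2" for v
    using power_mono[OF norm_bounded_op_le[OF vna_bounded_op[OF vn X], of "q v"] norm_ge_zero, of 2]
    by (simp add: Y_def c_def power_mult_distrib)
  ultimately have "0 \<le> Re (cinner \<xi> (\<Phi> P \<xi>))"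
    by (intro ncp_positive) (simp_all del: of_real_diff of_real_mult of_real_power)
  \<comment> \<open>The \<open>q\<close> term of \<open>P\<close> disappears by
    \<open>null\<close>.\<close>
  also have "\<dots> = - Re (cinner \<xi> (\<Phi> Z \<xi>))"
    using null[folded q_def] unfolding P_def ncp_diff[OF qc Z] ncp_cscale[OF q]
    by (simp add: cinner_simps)
  also have "\<dots> \<le> - (norm (\<Phi> Y \<xi>))\<^sup>2"
    using kadison_schwarz[OF Y, of \<xi>] by (simp add: Z_def)
  finally have "\<Phi> Y \<xi> = 0"
    by simp
  moreover have "Y = (\<lambda>x. X x - X (p x))"
    by (simp add: Y_def q_def bounded_op_diff[OF vna_bounded_op[OF vn X]])
  ultimately show ?thesis
    using ncp_diff[OF X vna_comp[OF vn X p(1)]] by simp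
qed

end

section \<open>CP-semigroups\<close>

context
  fixes M :: "('h::chilbert \<Rightarrow> 'h) set" and \<phi>
  assumes vn: "von_neumann_algebra M" and sg: "cp_semigroup M \<phi>"
begin

lemma cps_ncp: "t \<ge> 0 \<Longrightarrow> normal_cp_contraction M (\<phi> t)"
  and cps_0: "A \<in> M \<Longrightarrow> \<phi> 0 A = A"
  and cps_add: "s \<ge> 0 \<Longrightarrow> t \<ge> 0 \<Longrightarrow> A \<in> M \<Longrightarrow> \<phi> (s + t) A = \<phi> s (\<phi> t A)"
  using sg by (auto simp: cp_semigroup_def)

lemma cps_tendsto_cinner:
  assumes "A \<in> M" "t \<ge> 0"
  shows "((\<lambda>s. cinner \<xi> (\<phi> s A \<eta>)) \<longlongrightarrow> cinner \<xi> (\<phi> t A \<eta>)) (at t within {0..})"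
  using sg assms normal_functional_vector[of M \<xi> \<eta>] unfolding cp_semigroup_def by blast

lemma cps_in: "t \<ge> 0 \<Longrightarrow> A \<in> M \<Longrightarrow> \<phi> t A \<in> M"
  by (rule ncp_in[OF vn cps_ncp])

text \<open>Expand the squared norm of the difference. Kadison-Schwarz bounds its only term
  quadratic in \<open>\<phi> t A\<close> by one linear in \<open>\<phi> t\<close>, which weak
  continuity controls.\<close>

lemma cps_strong_continuous_0:
  assumes A: "A \<in> M"
  shows "((\<lambda>t. \<phi> t A v) \<longlongrightarrow> A v) (at 0 within {0..})"
proof -
  define B where "B = (\<lambda>x. adjoint_op A (A x))"
  have B: "B \<in> M"
    unfolding B_def by (rule vna_comp[OF vn vna_adjoint[OF vn A] A])
  define g where "g t = Re (cinner v (\<phi> t B v)) - 2 * Re (cinner (A v) (\<phi> t A v)) + (norm (A v))\<^sup>2" for t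
  have "(g \<longlongrightarrow> Re (cinner v (\<phi> 0 B v)) - 2 * Re (cinner (A v) (\<phi> 0 A v)) + (norm (A v))\<^sup>2)
      (at 0 within {0..})"
    unfolding g_def by (intro tendsto_intros cps_tendsto_cinner A B order_refl)
  moreover have "Re (cinner v (\<phi> 0 B v)) = (norm (A v))\<^sup>2"
    unfolding cps_0[OF B]
    by (simp add: B_def adjoint_op[OF vna_bounded_op[OF vn A], symmetric] Re_cinner_self)
  ultimately have "(g \<longlongrightarrow> 0) (at 0 within {0..})"
    by (simp add: cps_0 A Re_cinner_self)
  moreover have "(norm (\<phi> t A v - A v))\<^sup>2 \<le> g t" if "t \<ge> 0" for t
    using kadison_schwarz[OF vn cps_ncp[OF that] A, of v]
    by (simp add: g_def norm_diff_square Re_cinner_commute[of "A v"] B_def)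
  then have "\<forall>\<^sub>F t in at 0 within {0..}. norm ((norm (\<phi> t A v - A v))\<^sup>2) \<le> g t"
    by (auto simp: eventually_at_filter)
  ultimately have "((\<lambda>t. (norm (\<phi> t A v - A v))\<^sup>2) \<longlongrightarrow> 0) (at 0 within {0..})"
    by (rule Lim_null_comparison[rotated])
  then have "((\<lambda>t. norm (\<phi> t A v - A v)) \<longlongrightarrow> 0) (at 0 within {0..})"
    using tendsto_real_sqrt[of "\<lambda>t. (norm (\<phi> t A v - A v))\<^sup>2" 0] by simp
  then show ?thesis
    using tendsto_norm_zero_iff Lim_null by blast
qed

text \<open>For an increment \<open>h > 0\<close> continuity at 0 applies to the fixed operator
  \<open>\<phi> t A\<close>; a decrement would make that operator vary.\<close>

lemma cps_strong_right_continuous: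
  assumes A: "A \<in> M" and t: "t \<ge> 0"
  shows "((\<lambda>s. \<phi> s A v) \<longlongrightarrow> \<phi> t A v) (at_right t)"
  unfolding filterlim_at_right_to_0[of _ _ t]
proof (rule Lim_transform_eventually)
  show "((\<lambda>h. \<phi> h (\<phi> t A) v) \<longlongrightarrow> \<phi> t A v) (at_right 0)"
    by (rule tendsto_within_subset[OF cps_strong_continuous_0[OF cps_in[OF t A]]]) auto
  show "\<forall>\<^sub>F h in at_right 0. \<phi> h (\<phi> t A) v = \<phi> (h + t) A v"
    by (auto simp: eventually_at_filter cps_add t A)
qed

text \<open>The projection onto the smallest \<open>M'\<close>-invariant closed subspace containing the countably many
  vectors that the functionals \<open>\<langle>\<xi>, \<phi> q (\<cdot>) \<xi>\<rangle>\<close>, \<open>q\<close> rational, depend on.\<close>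
lemma cps_countable_support:
  obtains S p where "countable S" "p \<in> M" "\<And>x y. cinner (p x) y = cinner x (p y)"
    "\<And>x. p (p x) = p x" "\<And>x. norm (p x) \<le> norm x"
    "\<And>x. p x \<in> closure (span {T v | T v. T \<in> commutant M \<and> v \<in> S})"
    "\<And>t. t \<ge> 0 \<Longrightarrow> cinner \<xi> (\<phi> t (\<lambda>x. x - p x) \<xi>) = 0"
proof -
  have "\<exists>S. countable S \<and> (\<forall>B\<in>M. (\<forall>v\<in>S. B v = 0) \<longrightarrow> cinner \<xi> (\<phi> q B \<xi>) = 0)" if "q \<ge> 0" for q
    using ncp_kernel_countable[OF vn cps_ncp[OF that]] .
  then obtain S' where S': "\<And>q. q \<ge> 0 \<Longrightarrow> countable (S' q)"
    "\<And>q B. q \<ge> 0 \<Longrightarrow> B \<in> M \<Longrightarrow> (\<forall>v\<in>S' q. B v = 0) \<Longrightarrow> cinner \<xi> (\<phi> q B \<xi>) = 0"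
    by metis
  \<comment> \<open>\<open>S\<close> must serve every time at once, since the main argument picks
    \<open>r\<close> only after \<open>S\<close>. Rational times keep it countable.\<close>
  define Q where "Q = \<rat> \<inter> {0::real..}"
  define S where "S = (\<Union>q\<in>Q. S' q)"
  have S: "countable S"
    unfolding S_def Q_def using S'(1) by (intro countable_UN) (auto intro: countable_subset[OF _ countable_rat])
  define G where "G = {T v | T v. T \<in> commutant M \<and> v \<in> S}"
  define K where "K = closure (span G)"
  have "T k \<in> K" if T: "T \<in> commutant M" and k: "k \<in> K" for T k
  proof -
    interpret T: bounded_linear T
      using T by (auto simp: commutant_def intro: bounded_op_imp_bounded_linear)
    \<comment> \<open>The commutant is closed under composition; linearity and continuity of
      \<open>T\<close> extend invariance to the closed span.\<close>
    have "T ` G \<subseteq> G"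
      unfolding G_def using commutant_comp[OF T] by fastforce
    then have "T ` span G \<subseteq> span G"
      using linear_span_image[OF T.linear_axioms, of G] span_mono by metis
    then have "T ` K \<subseteq> K"
      unfolding K_def using closure_mono
      by (intro image_closure_subset T.continuous_on continuous_on_id closed_closure)
        (use closure_subset in blast)
    then show ?thesis using k by blast
  qed
  moreover have "subspace K" "closed K"
    by (simp_all add: K_def subspace_closure)
  ultimately obtain p where p: "p \<in> M" "\<And>x. p x \<in> K" "\<And>k. k \<in> K \<Longrightarrow> p k = k"
    "\<And>x y. cinner (p x) y = cinner x (p y)" "\<And>x. norm (p x) \<le> norm x"
    using vna_projection[OF vn] by metis
  define q where "q = (\<lambda>x. x - p x)"
  have qM: "q \<in> M"
    unfolding q_def by (rule vna_diff[OF vn vna_id[OF vn] p(1)])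
  \<comment> \<open>The identity lies in the commutant, so \<open>S\<close> is contained in
    \<open>K\<close>.\<close>
  have q_S: "q v = 0" if "v \<in> S" for v
  proof -
    have "(\<lambda>x. x) \<in> commutant M"
      by (auto simp: commutant_def bounded_op_id)
    then have "v \<in> G"
      using that by (auto simp: G_def)
    then have "v \<in> K"
      unfolding K_def using closure_subset span_superset by blast
    then show ?thesis
      by (simp add: q_def p(3))
  qed
  have rational: "cinner \<xi> (\<phi> r q \<xi>) = 0" if "r \<in> Q" for r
    using that by (intro S'(2) qM) (auto simp: S_def Q_def intro!: q_S)
  have "cinner \<xi> (\<phi> t q \<xi>) = 0" if t: "t \<ge> 0" for t
  proof -
    have "t \<in> closure Q"
    proof (unfold closure_approachable, intro allI impI)
      fix e :: real assume "e > 0"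
      then obtain r where "r \<in> \<rat>" "t < r" "r < t + e"
        using Rats_dense_in_real[of t "t + e"] by auto
      with t show "\<exists>r\<in>Q. dist r t < e"
        by (intro bexI[of _ r]) (auto simp: Q_def dist_real_def)
    qed
    moreover have "continuous_on {0..} (\<lambda>t. cinner \<xi> (\<phi> t q \<xi>))"
      by (simp add: continuous_on cps_tendsto_cinner qM)
    ultimately show ?thesis
      using continuous_constant_on_closure[of Q "\<lambda>t. cinner \<xi> (\<phi> t q \<xi>)" 0 t] rational
        continuous_on_subset[of "{0..}" "\<lambda>t. cinner \<xi> (\<phi> t q \<xi>)" "closure Q"]
        closure_minimal[of Q "{0..}"]
      by (auto simp: Q_def)
  qed
  then show ?thesis
    using that[of S p] S p unfolding K_def G_def q_def by blast
qed

lemma cps_strong_continuous_pos: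
  assumes A: "A \<in> M" and t0: "t0 > 0"
  shows "((\<lambda>t. norm (\<phi> t A \<xi> - \<phi> t0 A \<xi>)) \<longlongrightarrow> 0) (at t0 within {0..})"
proof -
  obtain S p where S: "countable S" and p: "p \<in> M" "\<And>x y. cinner (p x) y = cinner x (p y)"
      "\<And>x. p (p x) = p x" and p_le: "\<And>x. norm (p x) \<le> norm x"
    and pK: "\<And>x. p x \<in> closure (span {T v | T v. T \<in> commutant M \<and> v \<in> S})"
    and null: "\<And>t. t \<ge> 0 \<Longrightarrow> cinner \<xi> (\<phi> t (\<lambda>x. x - p x) \<xi>) = 0"
    by (rule cps_countable_support[of \<xi>]) (rule that)
  \<comment> \<open>The times to be avoided by \<open>u\<close>, which plays the role of
    \<open>t0 - r\<close>.\<close>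
  define N where "N = (\<Union>v\<in>S. {t. t \<ge> 0 \<and> \<not> isCont (\<lambda>s. \<phi> s A v) t})"
  have "countable N"
    unfolding N_def using S
    by (intro countable_UN countable_discontinuities_right_continuous cps_strong_right_continuous A)
  moreover have "uncountable {0<..<t0}"
    using t0 by (simp add: uncountable_open_interval)
  ultimately obtain u where u: "0 < u" "u < t0" "u \<notin> N"
    by (metis countable_subset greaterThanLessThan_iff subsetI)
  define r where "r = t0 - u"
  have r: "0 \<le> r" "r < t0"
    using u by (simp_all add: r_def)
  \<comment> \<open>The \<open>max\<close> keeps the time nonnegative, so that \<open>E s\<close> is
    in \<open>M\<close> and bounded for every \<open>s\<close>; near \<open>t0\<close> the time is
    just \<open>s - r\<close>.\<close>
  define E where "E s = (\<lambda>x. \<phi> (max r s - r) A x - \<phi> u A x)" for s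
  have EM: "E s \<in> M" for s
    unfolding E_def using u by (intro vna_diff[OF vn, of "\<phi> _ A" "\<phi> u A"] cps_in A) auto
  have E_le: "norm (E s v) \<le> 2 * onorm A * norm v" for s v
    using norm_triangle_ineq4[of "\<phi> (max r s - r) A v" "\<phi> u A v"]
      ncp_norm_le[OF vn cps_ncp A, of "max r s - r" v] ncp_norm_le[OF vn cps_ncp A, of u v] u(1)
    by (simp add: E_def)
  have E_S: "((\<lambda>s. E s v) \<longlongrightarrow> 0) (at t0 within {0..})" if "v \<in> S" for v
  proof -
    have "isCont (\<lambda>s. \<phi> s A v) u"
      using u that by (auto simp: N_def)
    moreover have "((\<lambda>s. max r s - r) \<longlongrightarrow> max r t0 - r) (at t0 within {0..})"
      by (intro tendsto_intros)
    then have "((\<lambda>s. max r s - r) \<longlongrightarrow> u) (at t0 within {0..})"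
      using r(2) by (simp add: r_def)
    ultimately have "((\<lambda>s. \<phi> (max r s - r) A v) \<longlongrightarrow> \<phi> u A v) (at t0 within {0..})"
      by (rule isCont_tendsto_compose)
    then show ?thesis
      unfolding E_def by (rule Lim_null[THEN iffD1])
  qed
  \<comment> \<open>Since \<open>T\<close> commutes with \<open>E s\<close>, convergence at
    \<open>w\<close> carries over to \<open>T w\<close>.\<close>
  have E_G: "((\<lambda>s. E s v) \<longlongrightarrow> 0) (at t0 within {0..})"
    if G: "v \<in> {T v | T v. T \<in> commutant M \<and> v \<in> S}" for v
  proof -
    obtain T w where v: "v = T w" and T: "T \<in> commutant M" and w: "w \<in> S"
      using G by auto
    have bT: "bounded_op T" using T by (simp add: commutant_def)
    have "((\<lambda>s. T (E s w)) \<longlongrightarrow> T 0) (at t0 within {0..})"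
      by (rule bounded_linear.tendsto[OF bounded_op_imp_bounded_linear[OF bT] E_S[OF w]])
    then show ?thesis
      using bT by (simp add: v commutant_commute[OF T EM])
  qed
  have E_p: "((\<lambda>s. E s (p v)) \<longlongrightarrow> 0) (at t0 within {0..})" for v
    by (rule tendsto_zero_closure_span[OF _ E_le E_G pK])
      (auto intro: bounded_linear.linear bounded_op_imp_bounded_linear vna_bounded_op[OF vn EM])
  have "((\<lambda>s. \<phi> r (\<lambda>x. E s (p x)) \<xi>) \<longlongrightarrow> 0) (at t0 within {0..})"
  proof (rule ncp_bounded_strong_tendsto_zero[OF vn cps_ncp[OF r(1)]])
    show "(\<lambda>x. E s (p x)) \<in> M" for s
      by (rule vna_comp[OF vn EM p(1)])
    show "norm (E s (p v)) \<le> 2 * onorm A * norm v" for s v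
      using E_le[of s "p v"] mult_left_mono[OF p_le, of "2 * onorm A" v]
        onorm_pos_le[OF bounded_op_imp_bounded_linear[OF vna_bounded_op[OF vn A]]] by simp
  qed (rule E_p)
  \<comment> \<open>As \<open>1 - p\<close> is null for the functional at time \<open>r\<close>, the
    factor \<open>p\<close> may be dropped.\<close>
  then have lim: "((\<lambda>s. \<phi> r (E s) \<xi>) \<longlongrightarrow> 0) (at t0 within {0..})"
    by (simp add: ncp_cut_down[OF vn cps_ncp[OF r(1)] p null[OF r(1)] EM])
  have "\<forall>\<^sub>F s in at t0 within {0..}. r < s"
    using r(2) by (intro order_tendstoD(1)[OF tendsto_ident_at])
  then have "\<forall>\<^sub>F s in at t0 within {0..}. \<phi> r (E s) \<xi> = \<phi> s A \<xi> - \<phi> t0 A \<xi>"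
  proof eventually_elim
    fix s assume s: "r < s"
    have "\<phi> r (E s) = (\<lambda>x. \<phi> r (\<phi> (s - r) A) x - \<phi> r (\<phi> u A) x)"
      unfolding E_def using s u by (subst ncp_diff[OF vn cps_ncp[OF r(1)]]) (auto simp: cps_in A)
    then show "\<phi> r (E s) \<xi> = \<phi> s A \<xi> - \<phi> t0 A \<xi>"
      using cps_add[OF r(1), of "s - r" A] cps_add[OF r(1), of u A] s u A by (simp add: r_def)
  qed
  with lim show ?thesis
    by (intro tendsto_norm_zero) (rule Lim_transform_eventually)
qed

end

theorem theorem3p1:
  fixes M :: "('h::chilbert \<Rightarrow> 'h) set"
    and \<phi> :: "real \<Rightarrow> ('h \<Rightarrow> 'h) \<Rightarrow> ('h \<Rightarrow> 'h)"
  assumes "von_neumann_algebra M"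
    and "cp_semigroup M \<phi>"
    and "A \<in> M"
    and "t0 \<ge> 0"
  shows "((\<lambda>t. norm (\<phi> t A \<xi> - \<phi> t0 A \<xi>)) \<longlongrightarrow> 0) (at t0 within {0..})"
proof (cases "t0 = 0")
  \<comment> \<open>There is no room below 0 for an intermediate time, but continuity at 0 within
    \<open>{0..}\<close> is already the one-sided statement.\<close>
  case True
  then show ?thesis
    using cps_strong_continuous_0[OF assms(1-3), of \<xi>] cps_0[OF assms(1-3)]
    by (simp add: tendsto_norm_zero_iff flip: Lim_null)
next
  case False
  then show ?thesis
    using cps_strong_continuous_pos[OF assms(1-3)] assms(4) by simp
qed

end
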